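(* Let $(\beta,\lessdot)$ be a prioritized Bundle Event Structure with $\beta=(E,\#,\mapsto,l)$, let $\langle C,\preceq_C,l|_C\rangle\in\mathrm{lposets}(\beta)$, and let $\lessdot'=\lessdot\setminus\{(e,e')\mid e'\preceq_C e\vee e\preceq_C e'\}$. Then $\mathrm{Traces}(\beta,\lessdot)|_C=\mathrm{Traces}(\beta,\lessdot')|_C$.
   Context: A Bundle Event Structure (BES) is a quadruple $\beta=(E,\#,\mapsto,l)$ where $E$ is a set of events, $\#\subseteq E\times E$ is an irreflexive symmetric relation (conflict), $\mapsto\subseteq\mathcal{P}(E)\times E$ is the enabling relation (a pair $(X,e)$ is written $X\mapsto e$), and $l:E\to Act$ is a labeling function, satisfying Stability: whenever $X\mapsto e$, any two distinct $e_1,e_2\in X$ satisfy $e_1\# e_2$. For a finite sequence $\sigma=e_1\cdots e_n$ of events write $\bar\sigma=\{e_1,\dots,e_n\}$ and $\sigma_i=e_1\cdots e_i$ ($\sigma_0$ empty). Define $\mathrm{en}_\beta(\sigma)=\{e\in E\setminus\bar\sigma\mid (\forall X\subseteq E.\ X\mapsto e\Rightarrow X\cap\bar\sigma\neq\emptyset)\wedge\neg\exists e'\in\bar\sigma.\ e\# e'\}$. $\sigma$ is a trace of $\beta$ iff $e_i\in\mathrm{en}_\beta(\sigma_{i-1})$ for all $1\le i\le n$. A set $C\subseteq E$ is a configuration of $\beta$ iff $C=\bar\sigma$ for some trace $\sigma$ of $\beta$. For a configuration $C$, define $\prec_C\subseteq C\times C$ by $e\prec_C e'$ iff $\exists X\subseteq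 E.\ e\in X\wedge X\mapsto e'$, and let $\preceq_C$ be the reflexive and transitive closure of $\prec_C$ on $C$. $\mathrm{lposets}(\beta)$ is the set of triples $\langle C,\preceq_C,l|_C\rangle$ for all configurations $C$ of $\beta$. A prioritized BES (PBES) is a pair $(\beta,\lessdot)$ with $\lessdot\subseteq E\times E$ acyclic ($e\lessdot e'$: $e'$ has higher priority). $\sigma=e_1\cdots e_n$ is a trace of $(\beta,\lessdot)$ iff $\sigma$ is a trace of $\beta$ and for all $0\le i<n$ and all $e_j,e_h\in\bar\sigma$ with $e_j\neq e_h$, $e_j,e_h\in\mathrm{en}_\beta(\sigma_i)$ and $e_h\lessdot e_j$, we have $j<h$; $\mathrm{Traces}(\beta,\lessdot)$ is the set of these traces (same for subrelations of $\lessdot$), and $\mathrm{Traces}(\beta,\lessdot)|_C=\{\sigma\in\mathrm{Traces}(\beta,\lessdot)\mid\bar\sigma=C\}$. *)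

theory Defs
  imports Main "HOL-Library.FuncSet"
begin

record ('e, 'act) event_structure =
  events :: "'e set"
  conflict :: "('e \<times> 'e) set"
  enabling :: "('e set \<times> 'e) set"
  label :: "'e \<Rightarrow> 'act"

text \<open>The set of actions is the type \<open>'act\<close>; values of the labelling outside the set of events
  are never used.\<close>

definition bes :: "('e, 'act) event_structure \<Rightarrow> bool" where
  "bes \<beta> \<longleftrightarrow>
     conflict \<beta> \<subseteq> events \<beta> \<times> events \<beta> \<and>
     irrefl (conflict \<beta>) \<and> sym (conflict \<beta>) \<and>
     enabling \<beta> \<subseteq> Pow (events \<beta>) \<times> events \<beta> \<and>
     (\<forall>X e. (X, e) \<in> enabling \<beta> \<longrightarrow>
        (\<forall>e1 \<in> X. \<forall>e2 \<in> X. e1 \<noteq> e2 \<longrightarrow> (e1, e2) \<in> conflict \<beta>))"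

definition pbes :: "('e, 'act) event_structure \<Rightarrow> ('e \<times> 'e) set \<Rightarrow> bool" where
  "pbes \<beta> prio \<longleftrightarrow> bes \<beta> \<and> prio \<subseteq> events \<beta> \<times> events \<beta> \<and> acyclic prio"

definition en :: "('e, 'act) event_structure \<Rightarrow> 'e list \<Rightarrow> 'e set" where
  "en \<beta> \<sigma> = {e \<in> events \<beta> - set \<sigma>.
     (\<forall>X \<subseteq> events \<beta>. (X, e) \<in> enabling \<beta> \<longrightarrow> X \<inter> set \<sigma> \<noteq> {}) \<and>
     \<not> (\<exists>e' \<in> set \<sigma>. (e, e') \<in> conflict \<beta>)}"

text \<open>Sequences are indexed from 0, so \<open>\<sigma> ! i\<close> is preceded by \<open>take i \<sigma>\<close>.\<close>

definition bes_trace :: "('e, 'act) event_structure \<Rightarrow> 'e list \<Rightarrow> bool" where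
  "bes_trace \<beta> \<sigma> \<longleftrightarrow> (\<forall>i < length \<sigma>. \<sigma> ! i \<in> en \<beta> (take i \<sigma>))"

definition configuration :: "('e, 'act) event_structure \<Rightarrow> 'e set \<Rightarrow> bool" where
  "configuration \<beta> C \<longleftrightarrow> (\<exists>\<sigma>. bes_trace \<beta> \<sigma> \<and> C = set \<sigma>)"

definition prec :: "('e, 'act) event_structure \<Rightarrow> 'e set \<Rightarrow> ('e \<times> 'e) set" where
  "prec \<beta> C = {(e, e') \<in> C \<times> C. \<exists>X \<subseteq> events \<beta>. e \<in> X \<and> (X, e') \<in> enabling \<beta>}"

definition preceq :: "('e, 'act) event_structure \<Rightarrow> 'e set \<Rightarrow> ('e \<times> 'e) set" where
  "preceq \<beta> C = Id_on C \<union> (prec \<beta> C)\<^sup>+"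

definition lposets ::
    "('e, 'act) event_structure \<Rightarrow> ('e set \<times> ('e \<times> 'e) set \<times> ('e \<Rightarrow> 'act)) set" where
  "lposets \<beta> = {(C, preceq \<beta> C, restrict (label \<beta>) C) | C. configuration \<beta> C}"

text \<open>A pair \<open>(e, e') \<in> prio\<close> means that \<open>e'\<close> has the higher priority.\<close>

definition Traces :: "('e, 'act) event_structure \<Rightarrow> ('e \<times> 'e) set \<Rightarrow> 'e list set" where
  "Traces \<beta> prio = {\<sigma>. bes_trace \<beta> \<sigma> \<and>
     (\<forall>i < length \<sigma>. \<forall>j < length \<sigma>. \<forall>h < length \<sigma>.
        \<sigma> ! j \<noteq> \<sigma> ! h \<and> \<sigma> ! j \<in> en \<beta> (take i \<sigma>) \<and> \<sigma> ! h \<in> en \<beta> (take i \<sigma>) \<and>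
        (\<sigma> ! h, \<sigma> ! j) \<in> prio \<longrightarrow> j < h)}"

definition Traces_on ::
    "('e, 'act) event_structure \<Rightarrow> ('e \<times> 'e) set \<Rightarrow> 'e set \<Rightarrow> 'e list set" where
  "Traces_on \<beta> prio C = {\<sigma> \<in> Traces \<beta> prio. set \<sigma> = C}"

end

theory Submission
  imports Defs
begin

text \<open>If two distinct events of a trace are comparable under \<open>preceq\<close>, they are never enabled
  after the same prefix: since a trace is conflict-free, stability makes the event of a bundle
  that occurs in the trace unique, so all causes of an enabled event have already
  happened. Hence the priorities between comparable events impose no constraint.\<close>

text \<open>\<open>en\<close> forbids conflicts only with earlier events. Symmetry covers the
  opposite order of occurrence, irreflexivity the case \<open>x = y\<close>.\<close>

lemma bes_trace_conflict_free:
  assumes "bes \<beta>" "bes_trace \<beta> \<sigma>" "x \<in> set \<sigma>" "y \<in> set \<sigma>"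
  shows "(x, y) \<notin> conflict \<beta>"
proof
  assume xy: "(x, y) \<in> conflict \<beta>"
  then have yx: "(y, x) \<in> conflict \<beta>"
    using assms(1) by (auto simp: bes_def dest: symD)
  obtain a b where ab: "a < length \<sigma>" "x = \<sigma> ! a" "b < length \<sigma>" "y = \<sigma> ! b"
    using assms(3,4) by (metis in_set_conv_nth)
  have no_conflict: "(\<sigma> ! n, \<sigma> ! m) \<notin> conflict \<beta>" if "m < n" "n < length \<sigma>" for m n
  proof -
    have "\<sigma> ! m \<in> set (take n \<sigma>)"
      using that by (auto simp: in_set_conv_nth intro!: exI[of _ m])
    then show ?thesis
      using assms(2) that by (auto simp: bes_trace_def en_def)
  qed
  have "a \<noteq> b"
    using xy ab assms(1) by (auto simp: bes_def irrefl_def)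
  then show False
    using no_conflict[of a b] no_conflict[of b a] xy yx ab by (auto simp: nat_neq_iff)
qed

lemma prec_en_imp_past:
  assumes "bes \<beta>" "bes_trace \<beta> \<sigma>" "(e, e') \<in> prec \<beta> (set \<sigma>)" "e' \<in> en \<beta> (take i \<sigma>)"
  shows "e \<in> set (take i \<sigma>)"
proof -
  obtain X where X: "X \<subseteq> events \<beta>" "e \<in> X" "(X, e') \<in> enabling \<beta>" and e: "e \<in> set \<sigma>"
    using assms(3) by (auto simp: prec_def)
  obtain x where x: "x \<in> X" "x \<in> set (take i \<sigma>)"
    using assms(4) X unfolding en_def by blast
  then have "(x, e) \<notin> conflict \<beta>"
    using assms(1,2) e by (meson bes_trace_conflict_free in_set_takeD)
  \<comment> \<open>Stability: distinct members of the bundle \<open>X\<close> would be in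
    conflict.\<close>
  then have "x = e"
    using assms(1) X x unfolding bes_def by blast
  then show ?thesis using x by simp
qed

text \<open>At its own position \<open>k\<close> the event \<open>e'\<close> was enabled, so its
  causes lie in the still shorter prefix \<open>take k \<sigma>\<close>.\<close>

lemma prec_past_imp_past:
  assumes "bes \<beta>" "bes_trace \<beta> \<sigma>" "(e, e') \<in> prec \<beta> (set \<sigma>)" "e' \<in> set (take i \<sigma>)"
  shows "e \<in> set (take i \<sigma>)"
proof -
  obtain k where k: "k < i" "k < length \<sigma>" "e' = \<sigma> ! k"
    using assms(4) by (auto simp: in_set_conv_nth)
  then have "e \<in> set (take k \<sigma>)"
    using assms by (auto simp: bes_trace_def intro: prec_en_imp_past)
  then show ?thesis
    using k set_take_subset_set_take[of k i \<sigma>] by auto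
qed

text \<open>Only the last link of the chain uses that \<open>e'\<close> is enabled; every earlier
  link stays in the prefix because prefixes are closed under causes. Hence the induction extends the
  chain at its front.\<close>

lemma trancl_prec_en_imp_past:
  assumes "bes \<beta>" "bes_trace \<beta> \<sigma>" "(e, e') \<in> (prec \<beta> (set \<sigma>))\<^sup>+" "e' \<in> en \<beta> (take i \<sigma>)"
  shows "e \<in> set (take i \<sigma>)"
  using assms(3)
proof (induction rule: converse_trancl_induct)
  case (base y)
  then show ?case using assms by (blast intro: prec_en_imp_past)
next
  case (step y z)
  then show ?case using assms by (blast intro: prec_past_imp_past)
qed

text \<open>A proper cause of an enabled event has already occurred, and \<open>en\<close> excludes
  past events.\<close>

lemma en_preceq_imp_eq:
  assumes "bes \<beta>" "bes_trace \<beta> \<sigma>" "(e, e') \<in> preceq \<beta> (set \<sigma>)"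
    "e \<in> en \<beta> (take i \<sigma>)" "e' \<in> en \<beta> (take i \<sigma>)"
  shows "e = e'"
proof (rule ccontr)
  assume "e \<noteq> e'"
  then have "(e, e') \<in> (prec \<beta> (set \<sigma>))\<^sup>+"
    using assms(3) by (auto simp: preceq_def)
  then have "e \<in> set (take i \<sigma>)"
    using assms by (blast intro: trancl_prec_en_imp_past)
  then show False
    using assms(4) by (simp add: en_def)
qed

theorem theorem4:
  fixes \<beta> :: "('e, 'act) event_structure"
    and prio prio' :: "('e \<times> 'e) set"
    and C :: "'e set"
  assumes "pbes \<beta> prio"
    and "(C, preceq \<beta> C, restrict (label \<beta>) C) \<in> lposets \<beta>"
    and "prio' = prio - {(e, e'). (e', e) \<in> preceq \<beta> C \<or> (e, e') \<in> preceq \<beta> C}"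
  shows "Traces_on \<beta> prio C = Traces_on \<beta> prio' C"
proof -
  have bes: "bes \<beta>" using assms(1) by (simp add: pbes_def)
  \<comment> \<open>The premises mirror the guard in \<open>Traces\<close>: the priority is
    consulted only for such pairs. Comparability in either direction would force
    \<open>e = e'\<close>, so no such pair is removed from \<open>prio\<close>.\<close>
  have prio'_iff: "(e, e') \<in> prio \<longleftrightarrow> (e, e') \<in> prio'"
    if "bes_trace \<beta> \<sigma>" "set \<sigma> = C" "e' \<noteq> e" "e' \<in> en \<beta> (take i \<sigma>)" "e \<in> en \<beta> (take i \<sigma>)"
    for \<sigma> i e e'
    using en_preceq_imp_eq[OF bes that(1)] that assms(3) by blast
  have "\<sigma> \<in> Traces \<beta> prio \<longleftrightarrow> \<sigma> \<in> Traces \<beta> prio'" if "set \<sigma> = C" for \<sigma>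
    unfolding Traces_def using prio'_iff that by blast
  then show ?thesis by (auto simp: Traces_on_def)
qed

end
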